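(* Let $\langle X,\mu\rangle$ be a measure space (possibly with $\mu(X)=+\infty$). Let $f:X\to\mathbb{R}$ be a measurable function with $0\le f<M\in\mathbb{R}$. Let $I=(0,M)$ with the usual metric and let $s:[I]^{<\infty}\to\mathbb{R}\cup\{+\infty\}$ be defined as follows: for $H=\{a_1,\dots,a_n\}\in[I]^{<\infty}$ with $a_1<\dots<a_n$, put $a_0=0$, $a_{n+1}=M$ and \[s(H)=\sum_{i=0}^{n}a_i\,\mu\big(f^{-1}([a_i,a_{i+1}))\big),\] with the convention $0\cdot(+\infty)=0$. Then $\mathrm{ext}(s,I)$ exists and equals $\int_X f\,d\mu\in[0,+\infty]$.
   Context: For a set $I$, $[I]^{<\infty}$ is the set of all finite subsets of $I$. For a pseudo-metric space $(I,d)$, $A\subset I$ and $\epsilon>0$, let $S(A,\epsilon)=\bigcup_{x\in A}\{y\in I: d(x,y)<\epsilon\}$. The Hausdorff pseudo-metric on subsets of $I$ is $d_H(A,C)=\inf\{\epsilon>0: A\subset S(C,\epsilon),\ C\subset S(A,\epsilon)\}$ (with $\inf\emptyset=+\infty$). $I$ is totally bounded if for every $\delta>0$ there is a finite $K\subset I$ with $S(K,\delta)=I$. Let $(I,d)$ be a totally bounded pseudo-metric space and $s:[I]^{<\infty}\to\mathbb{R}\cup\{+\infty\}$. For $A\in\mathbb{R}$ we write $\mathrm{ext}(s,I)=A$ if for every $\epsilon>0$ there is $\delta>0$ such that $K\in[I]^{<\infty}$ and $d_H(K,I)<\delta$ imply $|s(K)-A|<\epsilon$ (in particular $s(K)<+\infty$).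 We write $\mathrm{ext}(s,I)=+\infty$ if for every $r\in\mathbb{N}$ there is $\delta>0$ such that $K\in[I]^{<\infty}$ and $d_H(K,I)<\delta$ imply $s(K)>r$. *)

theory Defs
  imports "HOL-Analysis.Analysis"
begin

definition nbhd :: "'a set \<Rightarrow> ('a \<Rightarrow> 'a \<Rightarrow> real) \<Rightarrow> 'a set \<Rightarrow> real \<Rightarrow> 'a set" where
  "nbhd I d A \<epsilon> = (\<Union>x\<in>A. {y \<in> I. d x y < \<epsilon>})"

text \<open>The infimum is taken in the extended reals, so that it is \<open>\<infinity>\<close> on the empty set.\<close>

definition hausdorff_pm :: "'a set \<Rightarrow> ('a \<Rightarrow> 'a \<Rightarrow> real) \<Rightarrow> 'a set \<Rightarrow> 'a set \<Rightarrow> ereal" where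
  "hausdorff_pm I d A C =
     Inf {ereal \<epsilon> | \<epsilon>. \<epsilon> > 0 \<and> A \<subseteq> nbhd I d C \<epsilon> \<and> C \<subseteq> nbhd I d A \<epsilon>}"

text \<open>
  \<open>has_ext I d s A\<close> stands for \<open>ext(s, I) = A\<close>. Only the values of \<open>s\<close> on finite subsets
  of \<open>I\<close> matter. The notion is meant for totally bounded pseudo-metric spaces, where \<open>A\<close> is
  unique (lemma \<open>has_ext_unique\<close> below).
\<close>

definition has_ext ::
    "'a set \<Rightarrow> ('a \<Rightarrow> 'a \<Rightarrow> real) \<Rightarrow> ('a set \<Rightarrow> ereal) \<Rightarrow> ereal \<Rightarrow> bool" where
  "has_ext I d s A = (case A of
     ereal a \<Rightarrow> \<forall>\<epsilon>::real. \<epsilon> > 0 \<longrightarrow> (\<exists>\<delta>::real. \<delta> > 0 \<and>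
       (\<forall>K. finite K \<and> K \<subseteq> I \<and> hausdorff_pm I d K I < ereal \<delta> \<longrightarrow> \<bar>s K - ereal a\<bar> < ereal \<epsilon>))
   | PInfty \<Rightarrow> \<forall>r::nat. \<exists>\<delta>::real. \<delta> > 0 \<and>
       (\<forall>K. finite K \<and> K \<subseteq> I \<and> hausdorff_pm I d K I < ereal \<delta> \<longrightarrow> s K > ereal (real r))
   | MInfty \<Rightarrow> False)"

locale totally_bounded_pseudometric =
  fixes I :: "'a set" and d :: "'a \<Rightarrow> 'a \<Rightarrow> real"
  assumes nonneg: "x \<in> I \<Longrightarrow> y \<in> I \<Longrightarrow> 0 \<le> d x y"
    and refl: "x \<in> I \<Longrightarrow> d x x = 0"
    and commute: "x \<in> I \<Longrightarrow> y \<in> I \<Longrightarrow> d x y = d y x"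
    and triangle: "x \<in> I \<Longrightarrow> y \<in> I \<Longrightarrow> z \<in> I \<Longrightarrow> d x z \<le> d x y + d y z"
    and totally_bounded: "\<delta> > 0 \<Longrightarrow> \<exists>K. finite K \<and> K \<subseteq> I \<and> nbhd I d K \<delta> = I"
begin

lemma ex_finite_hausdorff_close:
  assumes "\<delta> > (0::real)"
  shows "\<exists>K. finite K \<and> K \<subseteq> I \<and> hausdorff_pm I d K I < ereal \<delta>"
proof -
  obtain K where K: "finite K" "K \<subseteq> I" "nbhd I d K (\<delta>/2) = I"
    using totally_bounded[of "\<delta>/2"] assms by auto
  have "K \<subseteq> nbhd I d I (\<delta>/2)"
    using K(2) assms refl by (force simp: nbhd_def)
  then have "hausdorff_pm I d K I \<le> ereal (\<delta>/2)"
    unfolding hausdorff_pm_def using K(3) assms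
    by (intro Inf_lower CollectI exI[of _ "\<delta>/2"]) auto
  also have "\<dots> < ereal \<delta>" using assms by simp
  finally show ?thesis using K by blast
qed

lemma has_ext_unique:
  assumes A: "has_ext I d s A" and B: "has_ext I d s B"
  shows "A = B"
proof -
  have common: "\<exists>K. P K \<and> Q K"
    if near_P: "\<exists>\<delta>::real. \<delta> > 0 \<and> (\<forall>K. finite K \<and> K \<subseteq> I \<and> hausdorff_pm I d K I < ereal \<delta> \<longrightarrow> P K)"
      and near_Q: "\<exists>\<delta>::real. \<delta> > 0 \<and> (\<forall>K. finite K \<and> K \<subseteq> I \<and> hausdorff_pm I d K I < ereal \<delta> \<longrightarrow> Q K)"
    for P Q
  proof -
    obtain d1 :: real where d1: "d1 > 0"
      and P: "\<forall>K. finite K \<and> K \<subseteq> I \<and> hausdorff_pm I d K I < ereal d1 \<longrightarrow> P K"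
      using near_P by (elim exE conjE)
    obtain d2 :: real where d2: "d2 > 0"
      and Q: "\<forall>K. finite K \<and> K \<subseteq> I \<and> hausdorff_pm I d K I < ereal d2 \<longrightarrow> Q K"
      using near_Q by (elim exE conjE)
    obtain K where K: "finite K" "K \<subseteq> I" "hausdorff_pm I d K I < ereal (min d1 d2)"
      using ex_finite_hausdorff_close[of "min d1 d2"] d1 d2 by auto
    have "hausdorff_pm I d K I < ereal d1" "hausdorff_pm I d K I < ereal d2"
      using less_le_trans[OF K(3)] by auto
    then have "P K \<and> Q K" using P Q K(1,2) by simp
    then show ?thesis ..
  qed
  let ?near = "\<lambda>P. \<exists>\<delta>::real. \<delta> > 0 \<and>
    (\<forall>K. finite K \<and> K \<subseteq> I \<and> hausdorff_pm I d K I < ereal \<delta> \<longrightarrow> P K)"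
  have fin: "?near (\<lambda>K. \<bar>s K - ereal a\<bar> < ereal e)" if "has_ext I d s (ereal a)" "e > 0" for a e
    using that unfolding has_ext_def ereal.case by simp
  have inf: "?near (\<lambda>K. s K > ereal (real r))" if "has_ext I d s \<infinity>" for r
    using that unfolding has_ext_def infinity_ereal_def ereal.case by simp
  have fin_inf: False if a: "has_ext I d s (ereal a)" and i: "has_ext I d s \<infinity>" for a
  proof -
    obtain r :: nat where r: "a + 1 \<le> real r" using real_arch_simple by blast
    obtain K where "\<bar>s K - ereal a\<bar> < ereal 1" "s K > ereal (real r)"
      using common[OF fin[OF a zero_less_one] inf[OF i]] by blast
    then show False using r by (cases "s K") auto
  qed
  have fin_fin: "a = b" if a: "has_ext I d s (ereal a)" and b: "has_ext I d s (ereal b)" for a b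
  proof (rule ccontr)
    assume "a \<noteq> b"
    define e where "e = \<bar>a - b\<bar> / 2"
    have e: "e > 0" using \<open>a \<noteq> b\<close> by (simp add: e_def)
    obtain K where "\<bar>s K - ereal a\<bar> < ereal e" "\<bar>s K - ereal b\<bar> < ereal e"
      using common[OF fin[OF a e] fin[OF b e]] by blast
    then show False by (cases "s K") (auto simp: e_def abs_if split: if_splits)
  qed
  have "has_ext I d s (-\<infinity>) \<Longrightarrow> False"
    by (simp add: has_ext_def)
  then show ?thesis using A B fin_inf fin_fin by (cases A; cases B) auto
qed

end

lemma totally_bounded_pseudometric_interval:
  "totally_bounded_pseudometric {0<..<M::real} dist"
proof
  fix \<delta> :: real assume "\<delta> > 0"
  have "Met_TC.mtotally_bounded {0<..<M}"
    by (rule Met_TC.mtotally_bounded_subset[of "{0..M}"])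
      (auto intro!: Met_TC.compactin_imp_mtotally_bounded)
  then obtain K where "finite K" "K \<subseteq> {0<..<M}" "{0<..<M} \<subseteq> (\<Union>x\<in>K. ball x \<delta>)"
    using \<open>\<delta> > 0\<close> by (auto simp: Met_TC.mtotally_bounded_def)
  then show "\<exists>K. finite K \<and> K \<subseteq> {0<..<M} \<and> nbhd {0<..<M} dist K \<delta> = {0<..<M}"
    by (intro exI[of _ K]) (auto simp: nbhd_def subset_iff)
qed (simp_all add: dist_commute dist_triangle)

text \<open>
  The list \<open>a\<close> is \<open>a\<^sub>0 = 0 < a\<^sub>1 < \<dots> < a\<^sub>n < a\<^sub>n\<^sub>+\<^sub>1 = M\<close> with \<open>H = {a\<^sub>1, \<dots>, a\<^sub>n}\<close> and
  \<open>n = card H\<close>. In type \<^typ>\<open>ereal\<close> one has \<open>0 * \<infinity> = 0\<close>.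
\<close>

definition level_sum :: "'x measure \<Rightarrow> ('x \<Rightarrow> real) \<Rightarrow> real \<Rightarrow> real set \<Rightarrow> ereal" where
  "level_sum \<mu> f M H =
     (let a = 0 # sorted_list_of_set H @ [M] in
      \<Sum>i = 0..card H. ereal (a ! i) *
        enn2ereal (emeasure \<mu> (f -` {a ! i ..< a ! Suc i} \<inter> space \<mu>)))"

lemma level_sum_nonneg:
  assumes "finite H" "H \<subseteq> {0<..<M}"
  shows "0 \<le> level_sum \<mu> f M H"
proof -
  have "0 \<le> (0 # sorted_list_of_set H @ [M]) ! i" if "i \<le> card H" for i
  proof (cases i)
    case (Suc j)
    then have "j < length (sorted_list_of_set H)" using that assms(1) by simp
    then have "sorted_list_of_set H ! j \<in> H"
      using nth_mem[of j "sorted_list_of_set H"] assms(1) by simp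
    then show ?thesis using Suc assms(2) \<open>j < _\<close> by (auto simp: nth_append)
  qed simp
  then show ?thesis
    unfolding level_sum_def Let_def by (intro sum_nonneg ereal_0_le_mult) auto
qed

end

theory Submission
  imports Defs
begin

text \<open>
  The sum \<open>s(H)\<close> is the integral of the simple function \<open>g\<close> with \<open>g x\<close> the largest
  element of \<open>H \<union> {0}\<close> that is at most \<open>f x\<close>. If \<open>d\<^sub>H(H, I) < \<delta>\<close>, then
  \<open>f - 2\<delta> \<le> g \<le> f\<close>, hence \<open>\<integral> (f - 2\<delta>)\<^sup>+ \<le> s(H) \<le> \<integral> f\<close>. The lower bound
  tends to \<open>\<integral> f\<close> as \<open>\<delta>\<close> tends to \<open>0\<close> by monotone convergence, which remains valid when
  \<open>\<mu>\<close> is infinite and \<open>f - 2\<delta>\<close> itself is not integrable.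
\<close>

text \<open>The half-open cells between consecutive entries partition the range of \<open>y\<close>,
  so exactly one summand survives, and \<open>z\<close> is the left endpoint of its cell. Describing
  \<open>z\<close> by maximality in \<open>set b\<close> keeps indices out of later
  arguments.\<close>

lemma sum_mult_indicator_strict_sorted:
  fixes b :: "real list"
  assumes sorted: "sorted_wrt (<) b" and len: "length b = Suc (Suc n)"
    and y: "b ! 0 \<le> y" "y < b ! Suc n"
  obtains z where "(\<Sum>i\<le>n. ennreal (b ! i) * indicator {b ! i..<b ! Suc i} y) = ennreal z"
    and "z \<in> set b" and "z \<le> y" and "\<And>a. a \<in> set b \<Longrightarrow> a \<le> y \<Longrightarrow> a \<le> z"
proof -
  define k where "k = (GREATEST i. i \<le> n \<and> b ! i \<le> y)"
  have k: "k \<le> n \<and> b ! k \<le> y"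
    unfolding k_def by (rule GreatestI_nat[where k=0 and b=n]) (use y in auto)
  have k_max: "j \<le> k" if "j \<le> n" "b ! j \<le> y" for j
    unfolding k_def by (rule Greatest_le_nat[where b=n]) (use that in auto)
  have mono: "b ! i \<le> b ! j" if "i \<le> j" "j \<le> Suc n" for i j
    using sorted_wrt_nth_less[OF sorted, of i j] that len by (cases "i = j") auto
  \<comment> \<open>For \<open>k = n\<close> this is the assumed upper bound on \<open>y\<close>;
    for \<open>k < n\<close> it is the maximality of \<open>k\<close>.\<close>
  have "y < b ! Suc k"
    using k k_max[of "Suc k"] y by (cases "k = n") (auto simp: not_le[symmetric])
  have cell: "y \<in> {b ! i..<b ! Suc i} \<longleftrightarrow> i = k" if "i \<le> n" for i
  proof
    assume i: "y \<in> {b ! i..<b ! Suc i}"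
    have "\<not> i < k"
      using i k mono[of "Suc i" k] by auto
    then show "i = k" using k_max[of i] that i by auto
  qed (use k \<open>y < b ! Suc k\<close> in auto)
  have "(\<Sum>i\<le>n. ennreal (b ! i) * indicator {b ! i..<b ! Suc i} y) =
      (\<Sum>i\<le>n. if i = k then ennreal (b ! i) else 0)"
    using cell by (intro sum.cong) (simp_all add: indicator_def del: atLeastLessThan_iff)
  also have "\<dots> = ennreal (b ! k)" using k by simp
  finally have sum: "(\<Sum>i\<le>n. ennreal (b ! i) * indicator {b ! i..<b ! Suc i} y) = ennreal (b ! k)" .
  have max: "a \<le> b ! k" if "a \<in> set b" "a \<le> y" for a
  proof -
    obtain j where j: "j \<le> Suc n" "a = b ! j"
      using \<open>a \<in> set b\<close> len by (auto simp: in_set_conv_nth less_Suc_eq_le)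
    then have "j \<le> n" using that y by (cases "j = Suc n") auto
    then show ?thesis using k_max[of j] mono[of j k] j that k by auto
  qed
  show thesis
    using that[OF sum] k len max by auto
qed

text \<open>Integrate cell by cell and transfer the sum through \<open>enn2ereal\<close>, which
  respects sums and products; in both types \<open>0 * \<infinity> = 0\<close>.\<close>

lemma level_sum_eq_nn_integral:
  fixes f :: "'x \<Rightarrow> real"
  assumes f[measurable]: "f \<in> borel_measurable \<mu>" and H: "finite H" "H \<subseteq> {0<..<M}"
  shows "level_sum \<mu> f M H = enn2ereal (\<integral>\<^sup>+ x. (\<Sum>i\<le>card H.
    ennreal ((0 # sorted_list_of_set H @ [M]) ! i) *
    indicator {(0 # sorted_list_of_set H @ [M]) ! i..<(0 # sorted_list_of_set H @ [M]) ! Suc i} (f x)) \<partial>\<mu>)"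
proof -
  define b where "b = 0 # sorted_list_of_set H @ [M]"
  let ?A = "\<lambda>i. f -` {b ! i..<b ! Suc i} \<inter> space \<mu>"
  \<comment> \<open>Only left endpoints are covered: the last entry \<open>M\<close> may be negative
    when \<open>H\<close> is empty. Nonnegativity ensures that \<open>ennreal (b ! i)\<close> does
    not truncate the coefficient.\<close>
  have nonneg: "0 \<le> b ! i" if "i \<le> card H" for i
  proof -
    have "b ! i \<in> insert 0 H"
      using that H nth_mem[of "i - 1" "sorted_list_of_set H"]
      by (cases i) (auto simp: b_def nth_append)
    then show ?thesis using H by auto
  qed
  have "(\<integral>\<^sup>+ x. (\<Sum>i\<le>card H. ennreal (b ! i) * indicator {b ! i..<b ! Suc i} (f x)) \<partial>\<mu>) =
      (\<Sum>i\<le>card H. \<integral>\<^sup>+ x. ennreal (b ! i) * indicator {b ! i..<b ! Suc i} (f x) \<partial>\<mu>)"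
    by (rule nn_integral_sum) measurable
  also have "\<dots> = (\<Sum>i\<le>card H. ennreal (b ! i) * emeasure \<mu> (?A i))"
  proof (rule sum.cong[OF HOL.refl])
    fix i
    have "(\<integral>\<^sup>+ x. ennreal (b ! i) * indicator {b ! i..<b ! Suc i} (f x) \<partial>\<mu>) =
        (\<integral>\<^sup>+ x. ennreal (b ! i) * indicator (?A i) x \<partial>\<mu>)"
      by (rule nn_integral_cong) (simp add: indicator_def)
    also have "\<dots> = ennreal (b ! i) * emeasure \<mu> (?A i)"
      by (rule nn_integral_cmult_indicator) measurable
    finally show "(\<integral>\<^sup>+ x. ennreal (b ! i) * indicator {b ! i..<b ! Suc i} (f x) \<partial>\<mu>) =
        ennreal (b ! i) * emeasure \<mu> (?A i)" .
  qed
  finally have "enn2ereal (\<integral>\<^sup>+ x. (\<Sum>i\<le>card H. ennreal (b ! i) *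
        indicator {b ! i..<b ! Suc i} (f x)) \<partial>\<mu>) =
      (\<Sum>i\<le>card H. enn2ereal (ennreal (b ! i) * emeasure \<mu> (?A i)))"
    by simp
  also have "\<dots> = level_sum \<mu> f M H"
    unfolding level_sum_def Let_def b_def[symmetric] atLeast0AtMost
    by (intro sum.cong HOL.refl) (simp add: times_ennreal.rep_eq nonneg)
  finally show ?thesis by (simp add: b_def)
qed

text \<open>An infimum below \<delta> admits a radius \<open>e\<close> below \<delta>, and the
  \<open>e\<close>-neighbourhood of \<open>K\<close> covers \<open>I\<close>.\<close>

lemma hausdorff_pm_less_imp_near:
  assumes "hausdorff_pm I d K I < ereal \<delta>" "y \<in> I"
  obtains a where "a \<in> K" "d a y < \<delta>"
proof -
  obtain e where e: "ereal e < ereal \<delta>" "I \<subseteq> nbhd I d K e"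
    using assms(1) unfolding hausdorff_pm_def Inf_less_iff by auto
  then show thesis using that assms(2) by (force simp: nbhd_def)
qed

lemma level_sum_bounds:
  assumes f[measurable]: "f \<in> borel_measurable \<mu>"
    and f_bounds: "\<And>x. x \<in> space \<mu> \<Longrightarrow> 0 \<le> f x \<and> f x < M"
    and H: "finite H" "H \<subseteq> {0<..<M}" and "\<delta> > 0"
    and near: "hausdorff_pm {0<..<M} dist H {0<..<M} < ereal \<delta>"
  shows "level_sum \<mu> f M H \<le> enn2ereal (\<integral>\<^sup>+ x. ennreal (f x) \<partial>\<mu>)"
    and "enn2ereal (\<integral>\<^sup>+ x. ennreal (f x - 2 * \<delta>) \<partial>\<mu>) \<le> level_sum \<mu> f M H"
proof -
  define b where "b = 0 # sorted_list_of_set H @ [M]"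
  let ?g = "\<lambda>x. \<Sum>i\<le>card H. ennreal (b ! i) * indicator {b ! i..<b ! Suc i} (f x)"
  have pointwise: "ennreal (f x - 2 * \<delta>) \<le> ?g x \<and> ?g x \<le> ennreal (f x)" if x: "x \<in> space \<mu>" for x
  proof -
    \<comment> \<open>The point \<open>x\<close> itself forces \<open>M\<close> to be positive,
      which makes \<open>b\<close> strictly sorted even for empty \<open>H\<close>.\<close>
    have "0 < M" using f_bounds[OF x] by linarith
    have sorted: "sorted_wrt (<) b"
      using H \<open>0 < M\<close> by (auto simp: b_def sorted_wrt_append)
    have len: "length b = Suc (Suc (card H))" by (simp add: b_def)
    have first: "b ! 0 \<le> f x" and last: "f x < b ! Suc (card H)"
      using f_bounds[OF x] by (simp_all add: b_def nth_append)
    obtain z where z: "?g x = ennreal z" "z \<le> f x"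
      and z_max: "\<And>a. a \<in> set b \<Longrightarrow> a \<le> f x \<Longrightarrow> a \<le> z"
      by (rule sum_mult_indicator_strict_sorted[OF sorted len first last]) blast
    have "f x - 2 * \<delta> \<le> z"
    \<comment> \<open>For small \<open>f x\<close> the entry 0 of \<open>b\<close> suffices.
      Otherwise \<open>f x - \<delta>\<close> lies in the interval, and a point of \<open>H\<close>
      within \<delta> of it lies strictly between \<open>f x - 2 * \<delta>\<close> and
      \<open>f x\<close>; this is where the factor 2 comes from.\<close>
    proof (cases "f x \<le> \<delta>")
      case True
      then show ?thesis using z_max[of 0] f_bounds[OF x] \<open>\<delta> > 0\<close> by (simp add: b_def)
    next
      case False
      then obtain a where a: "a \<in> H" "dist a (f x - \<delta>) < \<delta>"
        using hausdorff_pm_less_imp_near[OF near, of "f x - \<delta>"] f_bounds[OF x] \<open>\<delta> > 0\<close> by auto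
      then have "\<bar>a - (f x - \<delta>)\<bar> < \<delta>" "a \<in> set b"
        using H by (simp_all add: b_def dist_real_def)
      then show ?thesis using z_max[of a] by linarith
    qed
    then show ?thesis using z by (simp add: ennreal_leI)
  qed
  have s: "level_sum \<mu> f M H = enn2ereal (\<integral>\<^sup>+ x. ?g x \<partial>\<mu>)"
    using level_sum_eq_nn_integral[OF f H] by (simp add: b_def)
  show "level_sum \<mu> f M H \<le> enn2ereal (\<integral>\<^sup>+ x. ennreal (f x) \<partial>\<mu>)"
    unfolding s less_eq_ennreal.rep_eq[symmetric] using pointwise by (intro nn_integral_mono) blast
  show "enn2ereal (\<integral>\<^sup>+ x. ennreal (f x - 2 * \<delta>) \<partial>\<mu>) \<le> level_sum \<mu> f M H"
    unfolding s less_eq_ennreal.rep_eq[symmetric] using pointwise by (intro nn_integral_mono) blast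
qed

text \<open>Since \<open>ennreal\<close> sends negative reals to 0, the integrands are positive
  parts that increase with \<open>n\<close>, so monotone convergence applies.\<close>

lemma nn_integral_minus_const_tendsto:
  fixes f :: "'x \<Rightarrow> real"
  assumes [measurable]: "f \<in> borel_measurable \<mu>"
  shows "(\<lambda>n. \<integral>\<^sup>+ x. ennreal (f x - 2 * inverse (real (Suc n))) \<partial>\<mu>)
    \<longlonglongrightarrow> (\<integral>\<^sup>+ x. ennreal (f x) \<partial>\<mu>)"
proof (rule nn_integral_LIMSEQ)
  show "incseq (\<lambda>n x. ennreal (f x - 2 * inverse (real (Suc n))))"
    by (auto simp: incseq_def le_fun_def intro!: ennreal_leI le_imp_inverse_le)
  show "(\<lambda>n. ennreal (f x - 2 * inverse (real (Suc n)))) \<longlonglongrightarrow> ennreal (f x)" for x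
    using tendsto_diff[OF tendsto_const tendsto_mult[OF tendsto_const LIMSEQ_inverse_real_of_nat],
        of "f x" 2]
    by (intro tendsto_ennrealI) simp
qed measurable

text \<open>This serves both the finite and the infinite integral: \<open>c\<close> becomes
  \<open>J - \<epsilon>\<close> in one case and \<open>r\<close> in the other.\<close>

lemma level_sum_greater:
  assumes f[measurable]: "f \<in> borel_measurable \<mu>"
    and f_bounds: "\<And>x. x \<in> space \<mu> \<Longrightarrow> 0 \<le> f x \<and> f x < M"
    and c: "c < enn2ereal (\<integral>\<^sup>+ x. ennreal (f x) \<partial>\<mu>)"
  obtains \<delta> :: real where "\<delta> > 0"
    and "\<And>K. finite K \<Longrightarrow> K \<subseteq> {0<..<M} \<Longrightarrow> hausdorff_pm {0<..<M} dist K {0<..<M} < ereal \<delta> \<Longrightarrow>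
      c < level_sum \<mu> f M K"
proof -
  have "(\<lambda>n. enn2ereal (\<integral>\<^sup>+ x. ennreal (f x - 2 * inverse (real (Suc n))) \<partial>\<mu>))
      \<longlonglongrightarrow> enn2ereal (\<integral>\<^sup>+ x. ennreal (f x) \<partial>\<mu>)"
    using nn_integral_minus_const_tendsto[OF f] by (rule tendsto_enn2erealI)
  from order_tendstoD(1)[OF this c]
  obtain n where n: "c < enn2ereal (\<integral>\<^sup>+ x. ennreal (f x - 2 * inverse (real (Suc n))) \<partial>\<mu>)"
    by (auto simp only: eventually_sequentially)
  show thesis
  \<comment> \<open>With this \<delta>, the constant subtracted in the chosen integral is exactly
    \<open>2 * \<delta>\<close>.\<close>
  proof (rule that[of "inverse (real (Suc n))"])
    show "c < level_sum \<mu> f M K"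
      if "finite K" "K \<subseteq> {0<..<M}"
        "hausdorff_pm {0<..<M} dist K {0<..<M} < ereal (inverse (real (Suc n)))" for K
      using n level_sum_bounds(2)[OF f f_bounds that(1,2) _ that(3)] by (auto intro: less_le_trans)
  qed simp
qed

theorem theorem6p4:
  fixes \<mu> :: "'x measure" and f :: "'x \<Rightarrow> real" and M :: real
  assumes "f \<in> borel_measurable \<mu>"
    and "\<And>x. x \<in> space \<mu> \<Longrightarrow> 0 \<le> f x \<and> f x < M"
  shows "has_ext {0<..<M} dist (level_sum \<mu> f M) (enn2ereal (\<integral>\<^sup>+ x. ennreal (f x) \<partial>\<mu>))"
proof (cases "enn2ereal (\<integral>\<^sup>+ x. ennreal (f x) \<partial>\<mu>)")
  case (real J)
  show ?thesis
    unfolding has_ext_def real ereal.case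
  proof (intro allI impI)
    fix \<epsilon> :: real assume "\<epsilon> > 0"
    then have "ereal (J - \<epsilon>) < enn2ereal (\<integral>\<^sup>+ x. ennreal (f x) \<partial>\<mu>)" by (simp add: real)
    then obtain \<delta> :: real where \<delta>: "\<delta> > 0"
      and lower: "\<And>K. finite K \<Longrightarrow> K \<subseteq> {0<..<M} \<Longrightarrow>
        hausdorff_pm {0<..<M} dist K {0<..<M} < ereal \<delta> \<Longrightarrow> ereal (J - \<epsilon>) < level_sum \<mu> f M K"
      using level_sum_greater[OF assms] by blast
    have "\<bar>level_sum \<mu> f M K - ereal J\<bar> < ereal \<epsilon>"
      if "finite K \<and> K \<subseteq> {0<..<M} \<and> hausdorff_pm {0<..<M} dist K {0<..<M} < ereal \<delta>" for K
    proof -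
      \<comment> \<open>The sums never exceed the integral, so closeness reduces to the lower
        estimate. The two bounds also make the sum finite.\<close>
      have "ereal (J - \<epsilon>) < level_sum \<mu> f M K" "level_sum \<mu> f M K \<le> ereal J"
        using lower that level_sum_bounds(1)[OF assms _ _ \<delta>] real by auto
      then show ?thesis using \<open>\<epsilon> > 0\<close> by (cases "level_sum \<mu> f M K") auto
    qed
    then show "\<exists>\<delta>>0. \<forall>K. finite K \<and> K \<subseteq> {0<..<M} \<and>
        hausdorff_pm {0<..<M} dist K {0<..<M} < ereal \<delta> \<longrightarrow>
        \<bar>level_sum \<mu> f M K - ereal J\<bar> < ereal \<epsilon>"
      using \<delta> by blast
  qed
next
  case PInf
  show ?thesis
    unfolding has_ext_def PInf infinity_ereal_def ereal.case
  proof
    fix r :: nat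
    have "ereal (real r) < enn2ereal (\<integral>\<^sup>+ x. ennreal (f x) \<partial>\<mu>)" by (simp add: PInf)
    then obtain \<delta> :: real where "\<delta> > 0"
      and "\<And>K. finite K \<Longrightarrow> K \<subseteq> {0<..<M} \<Longrightarrow>
        hausdorff_pm {0<..<M} dist K {0<..<M} < ereal \<delta> \<Longrightarrow> ereal (real r) < level_sum \<mu> f M K"
      using level_sum_greater[OF assms] by blast
    then show "\<exists>\<delta>>0. \<forall>K. finite K \<and> K \<subseteq> {0<..<M} \<and>
        hausdorff_pm {0<..<M} dist K {0<..<M} < ereal \<delta> \<longrightarrow> ereal (real r) < level_sum \<mu> f M K"
      by blast
  qed
next
  case MInf
  then show ?thesis using enn2ereal_nonneg[of "\<integral>\<^sup>+ x. ennreal (f x) \<partial>\<mu>"] by simp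
qed

end
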